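(* Let $G$ and $H$ be finite simple graphs on disjoint vertex sets, with $n_G=|V(G)|$ and $n_H=|V(H)|$. Let $G\ast H$ denote their join. Then \[ \nu(G\ast H)=\min\Big(\nu(G)+n_H,\ \nu(H)+n_G,\ \Big\lfloor\frac{n_G+n_H}{2}\Big\rfloor\Big). \]
   Context: For a finite simple graph $X$, $\nu(X)$ is the matching number: the largest number of pairwise vertex-disjoint edges of $X$ (so $\nu$ of the empty graph is $0$). The join $G\ast H$ of graphs on disjoint vertex sets has vertex set $V(G)\cup V(H)$ and edge set $E(G)\cup E(H)\cup\{gh: g\in V(G),\ h\in V(H)\}$. *)

theory Defs
  imports Main
begin

record 'a graph =
  verts :: "'a set"
  edges :: "'a set set"

definition finite_simple_graph :: "'a graph \<Rightarrow> bool" where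
  "finite_simple_graph G \<longleftrightarrow>
     finite (verts G) \<and> (\<forall>e\<in>edges G. e \<subseteq> verts G \<and> card e = 2)"

definition matching :: "'a graph \<Rightarrow> 'a set set \<Rightarrow> bool" where
  "matching G M \<longleftrightarrow> M \<subseteq> edges G \<and> pairwise disjnt M"

(* For a finite simple graph the set below is finite and contains 0 (the empty matching),
   so Max is meaningful. *)
definition matching_number :: "'a graph \<Rightarrow> nat" where
  "matching_number G = Max {card M | M. matching G M}"

definition graph_join :: "'a graph \<Rightarrow> 'a graph \<Rightarrow> 'a graph" where
  "graph_join G H =
     \<lparr> verts = verts G \<union> verts H,
       edges = edges G \<union> edges H \<union> {{g, h} | g h. g \<in> verts G \<and> h \<in> verts H} \<rparr>"

lemma finite_simple_graph_join:
  assumes "finite_simple_graph G" "finite_simple_graph H" "verts G \<inter> verts H = {}"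
  shows "finite_simple_graph (graph_join G H)"
  using assms unfolding finite_simple_graph_def graph_join_def
  by (fastforce simp: card_2_iff)

end

theory Submission
  imports Defs
begin

text \<open>
  Upper bound: fix a matching of the join. Its edges inside \<open>G\<close> number at most
  \<open>\<nu>(G)\<close>, and all others meet \<open>V(H)\<close>, in distinct vertices, so there are at most
  \<open>n\<^sub>H\<close> of them. Exchanging the graphs gives \<open>\<nu>(H) + n\<^sub>G\<close>, and counting covered
  vertices gives \<open>\<lfloor>(n\<^sub>G + n\<^sub>H)/2\<rfloor>\<close>.

  Lower bound: by commutativity of the join let \<open>n\<^sub>H \<le> n\<^sub>G\<close>. Then edges
  of \<open>G\<close> and edges between the two graphs suffice. A matching of \<open>G\<close> with \<open>a\<close> edges leaves \<open>n\<^sub>G - 2a\<close> vertices free, and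
  as long as this is at least \<open>n\<^sub>H\<close>, every vertex of \<open>H\<close> can be joined to a free vertex
  of its own, for a total of \<open>a + n\<^sub>H\<close> edges (\<open>matching_join_saturating\<close>). The largest
  admissible value \<open>a = min(\<nu>(G), \<lfloor>(n\<^sub>G - n\<^sub>H)/2\<rfloor>)\<close> yields
  \<open>min(\<nu>(G) + n\<^sub>H, \<lfloor>(n\<^sub>G + n\<^sub>H)/2\<rfloor>)\<close>, which is at least the claimed value.
\<close>

lemma finite_edges:
  assumes "finite_simple_graph G"
  shows "finite (edges G)"
  using assms unfolding finite_simple_graph_def
  by (intro finite_subset[of "edges G" "Pow (verts G)"]) auto

lemma finite_matching:
  assumes "finite_simple_graph G" "matching G M"
  shows "finite M"
  using assms finite_edges finite_subset unfolding matching_def by blast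

lemma matching_subset:
  assumes "matching G M" "N \<subseteq> M"
  shows "matching G N"
  using assms unfolding matching_def by (meson pairwise_subset subset_trans)

lemma finite_matching_sizes:
  assumes "finite_simple_graph G"
  shows "finite {card M | M. matching G M}"
proof -
  have "{card M | M. matching G M} \<subseteq> card ` Pow (edges G)"
    unfolding matching_def by blast
  then show ?thesis
    using finite_edges[OF assms] by (meson finite_Pow_iff finite_imageI finite_subset)
qed

lemma card_le_matching_number:
  assumes "finite_simple_graph G" "matching G M"
  shows "card M \<le> matching_number G"
  unfolding matching_number_def
  using assms by (intro Max_ge finite_matching_sizes) auto

lemma maximum_matching_exists:
  assumes "finite_simple_graph G"
  obtains M where "matching G M" "card M = matching_number G"
proof -
  have "matching G {}"
    unfolding matching_def by simp
  then have "matching_number G \<in> {card M | M. matching G M}"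
    unfolding matching_number_def using finite_matching_sizes[OF assms]
    by (intro Max_in) auto
  then show ?thesis
    using that by auto
qed

lemma matching_of_size_exists:
  assumes "finite_simple_graph G" "k \<le> matching_number G"
  obtains M where "matching G M" "card M = k"
proof -
  obtain M where M: "matching G M" "card M = matching_number G"
    using maximum_matching_exists[OF assms(1)] .
  then obtain N where "N \<subseteq> M" "card N = k"
    using assms(2) by (metis obtain_subset_with_card_n)
  then show ?thesis
    using M that matching_subset by blast
qed

lemma matching_covers_verts:
  assumes "finite_simple_graph G" "matching G M"
  shows "\<Union>M \<subseteq> verts G"
  using assms unfolding finite_simple_graph_def matching_def by blast

lemma card_covered_verts:
  assumes "finite_simple_graph G" "matching G M"
  shows "card (\<Union>M) = 2 * card M"
proof -
  have size2: "card e = 2" if "e \<in> M" for e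
    using assms that unfolding finite_simple_graph_def matching_def by blast
  have "card (\<Union>M) = sum card M"
    using assms(2) size2 unfolding matching_def
    by (intro card_Union_disjoint) (auto intro: card_ge_0_finite)
  then show ?thesis
    using size2 by simp
qed

text \<open>Choosing from each set a point of \<open>B\<close> is injective, since the sets are disjoint.\<close>

lemma card_disjoint_family_meeting_le:
  assumes "finite B" "pairwise disjnt F" "\<And>e. e \<in> F \<Longrightarrow> e \<inter> B \<noteq> {}"
  shows "card F \<le> card B"
proof -
  have "\<forall>e\<in>F. \<exists>x. x \<in> e \<inter> B"
    using assms(3) by blast
  then obtain p where p: "\<And>e. e \<in> F \<Longrightarrow> p e \<in> e \<inter> B"
    by metis
  have "inj_on p F"
    using p assms(2) unfolding inj_on_def pairwise_def disjnt_def by (metis IntE disjoint_iff)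
  then show ?thesis
    using p assms(1) by (intro card_inj_on_le[of p]) auto
qed

lemma graph_join_commute: "graph_join G H = graph_join H G"
proof -
  have "{{g, h} | g h. g \<in> verts G \<and> h \<in> verts H} = {{g, h} | g h. g \<in> verts H \<and> h \<in> verts G}"
    by (auto simp: insert_commute)
  then show ?thesis
    unfolding graph_join_def by (simp add: Un_commute)
qed

text \<open>
  The matching splits into its edges in \<open>G\<close> and the rest, each of which uses up a vertex
  of \<open>H\<close>.
\<close>

lemma matching_join_card_le:
  assumes G: "finite_simple_graph G" and H: "finite_simple_graph H"
    and M: "matching (graph_join G H) M"
  shows "card M \<le> matching_number G + card (verts H)"
proof -
  have "matching G (M \<inter> edges G)"
    using M unfolding matching_def by (meson Int_lower1 Int_lower2 pairwise_subset)
  then have in_G: "card (M \<inter> edges G) \<le> matching_number G"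
    using card_le_matching_number[OF G] by blast
  have meets_H: "e \<inter> verts H \<noteq> {}" if "e \<in> M - edges G" for e
  proof -
    have "e \<in> edges H \<or> (\<exists>g h. e = {g, h} \<and> h \<in> verts H)"
      using that M unfolding matching_def graph_join_def by auto
    moreover have "e \<subseteq> verts H \<and> e \<noteq> {}" if "e \<in> edges H"
      using that H unfolding finite_simple_graph_def by (metis card.empty zero_neq_numeral)
    ultimately show ?thesis
      by blast
  qed
  have "pairwise disjnt (M - edges G)"
    using M unfolding matching_def by (meson Diff_subset pairwise_subset)
  then have rest: "card (M - edges G) \<le> card (verts H)"
    using H meets_H unfolding finite_simple_graph_def
    by (intro card_disjoint_family_meeting_le) auto
  have "card M \<le> card (M \<inter> edges G) + card (M - edges G)"
    by (metis Int_Diff_Un card_Un_le)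
  then show ?thesis
    using in_G rest by linarith
qed

text \<open>
  The vertices of \<open>G\<close> missed by \<open>M\<close> are numerous enough to be matched, by edges of the
  join, with all of \<open>V(H)\<close>; these edges extend \<open>M\<close>.
\<close>

lemma matching_join_saturating:
  assumes G: "finite_simple_graph G" and H: "finite_simple_graph H"
    and disj: "verts G \<inter> verts H = {}"
    and M: "matching G M"
    and room: "2 * card M + card (verts H) \<le> card (verts G)"
  shows "\<exists>N. matching (graph_join G H) N \<and> card N = card M + card (verts H)"
proof -
  have fin: "finite (verts G)" "finite (verts H)"
    using G H unfolding finite_simple_graph_def by auto
  have cov: "\<Union>M \<subseteq> verts G"
    using matching_covers_verts[OF G M] .
  have "card (verts G - \<Union>M) = card (verts G) - 2 * card M"
    using card_covered_verts[OF G M] cov fin by (metis card_Diff_subset finite_subset)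
  then have "card (verts H) \<le> card (verts G - \<Union>M)"
    using room by linarith
  then obtain f where f: "f ` verts H \<subseteq> verts G - \<Union>M" "inj_on f (verts H)"
    using fin by (metis card_le_inj finite_Diff)
  define C where "C = (\<lambda>h. {f h, h}) ` verts H"
  have f_in: "f h \<in> verts G" "f h \<notin> \<Union>M" if "h \<in> verts H" for h
    using f(1) that by auto
  have cross_disjoint: "{f h, h} \<inter> {f k, k} = {}"
    if "h \<in> verts H" "k \<in> verts H" "h \<noteq> k" for h k
    using that f_in[of h] f_in[of k] f(2) disj unfolding inj_on_def by blast
  have "inj_on (\<lambda>h. {f h, h}) (verts H)"
    using cross_disjoint by (intro inj_onI) (metis Int_absorb insert_not_empty)
  then have card_C: "card C = card (verts H)"
    unfolding C_def by (rule card_image)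
  have MC: "disjnt e d" if "e \<in> M" "d \<in> C" for e d
    using that f_in cov disj unfolding C_def disjnt_def by blast
  have "M \<inter> C = {}"
    using MC f_in unfolding C_def disjnt_def by blast
  then have card_union: "card (M \<union> C) = card M + card (verts H)"
    using card_C fin finite_matching[OF G M] by (simp add: card_Un_disjoint C_def)
  have "pairwise disjnt C"
    unfolding C_def pairwise_image disjnt_def
    using cross_disjoint by (intro pairwiseI) (simp only: simp_thms)
  moreover have "pairwise disjnt M"
    using M unfolding matching_def by blast
  ultimately have "pairwise disjnt (M \<union> C)"
    using MC unfolding pairwise_def by (metis Un_iff disjnt_sym)
  moreover have "M \<union> C \<subseteq> edges (graph_join G H)"
    using M f_in unfolding matching_def graph_join_def C_def by auto
  ultimately have "matching (graph_join G H) (M \<union> C)"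
    unfolding matching_def by blast
  then show ?thesis
    using card_union by blast
qed

lemma matching_number_join_ge:
  assumes G: "finite_simple_graph G" and H: "finite_simple_graph H"
    and disj: "verts G \<inter> verts H = {}"
    and le: "card (verts H) \<le> card (verts G)"
  shows "min (matching_number G + card (verts H)) ((card (verts G) + card (verts H)) div 2)
           \<le> matching_number (graph_join G H)"
proof -
  \<comment> \<open>the most edges of \<open>G\<close> that still leave \<open>n\<^sub>H\<close> vertices of \<open>G\<close> free\<close>
  define a where "a = min (matching_number G) ((card (verts G) - card (verts H)) div 2)"
  obtain M where M: "matching G M" "card M = a"
    using matching_of_size_exists[OF G, of a] unfolding a_def by auto
  have "2 * card M + card (verts H) \<le> card (verts G)"
    using le unfolding M(2) a_def by linarith
  then obtain N where "matching (graph_join G H) N" "card N = a + card (verts H)"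
    using matching_join_saturating[OF G H disj M(1)] M(2) by auto
  then have "a + card (verts H) \<le> matching_number (graph_join G H)"
    using card_le_matching_number[OF finite_simple_graph_join[OF G H disj]] by metis
  moreover have "a + card (verts H) =
      min (matching_number G + card (verts H)) ((card (verts G) + card (verts H)) div 2)"
    using le unfolding a_def by linarith
  ultimately show ?thesis
    by simp
qed

theorem theorem3p1:
  fixes G H :: "'a graph"
  assumes "finite_simple_graph G" and "finite_simple_graph H"
    and "verts G \<inter> verts H = {}"
  shows "matching_number (graph_join G H) =
           min (matching_number G + card (verts H))
             (min (matching_number H + card (verts G))
               ((card (verts G) + card (verts H)) div 2))"
proof -
  note J = finite_simple_graph_join[OF assms]
  obtain M where M: "matching (graph_join G H) M"
    "card M = matching_number (graph_join G H)"
    using maximum_matching_exists[OF J] .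
  have leG: "card M \<le> matching_number G + card (verts H)"
    using matching_join_card_le[OF assms(1,2) M(1)] .
  have leH: "card M \<le> matching_number H + card (verts G)"
    using matching_join_card_le[OF assms(2,1)] M(1) by (simp add: graph_join_commute)
  have "2 * card M \<le> card (verts G \<union> verts H)"
    using card_covered_verts[OF J M(1)] matching_covers_verts[OF J M(1)] assms(1,2)
    unfolding finite_simple_graph_def graph_join_def
    by (metis card_mono finite_UnI select_convs(1))
  then have le_half: "card M \<le> (card (verts G) + card (verts H)) div 2"
    using card_Un_le[of "verts G" "verts H"] by linarith
  have disj': "verts H \<inter> verts G = {}"
    using assms(3) by blast
  show ?thesis
  proof (cases "card (verts H) \<le> card (verts G)")
    case True
    then show ?thesis
      using matching_number_join_ge[OF assms] leG leH le_half M(2) by linarith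
  next
    case False
    then show ?thesis
      using matching_number_join_ge[OF assms(2,1) disj'] leG leH le_half M(2)
      by (simp add: graph_join_commute[of H G] add.commute)
  qed
qed

end
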